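(* Let $Q(x)=|x|^2/2$. If $$\frac{1}{|B_1|}\int_{B_1}|\tilde u(x)-Q(x)|^2\,dx\lesssim \delta^2$$ and $\tilde u$ is convex, then $$|\tilde u-Q|\lesssim \delta^{\mu}\quad\text{in }B_{1/2},$$ where $\mu=\frac{4}{4+n}$.
   Context: Here $n\ge 2$, $B_r$ denotes the open ball of radius $r$ centered at the origin of $\mathbb{R}^n$, $|B_1|$ is the Lebesgue measure of $B_1$, $\tilde u$ is a real-valued function on $B_1$, and $\delta>0$. Fixed throughout are $p>n$, $\alpha\in(0,1)$ and a constant $C_0>0$ (which in the surrounding setting bounds a density $\rho_0$ by $C_0^{-1}\le\rho_0\le C_0$). A constant is called universal if it depends only on $n$, $p$, $\alpha$ and $C_0$, and for positive quantities $a,b$ one writes $a\lesssim b$ if $a/b$ is bounded above by a universal constant.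
   Formalization: The formal statement assumes δ is bounded above by an arbitrary fixed constant, on which the final constant may depend; for unbounded δ the claim fails, e.g. for ũ = Q + δ with δ → ∞, since μ < 1. *)

theory Defs
  imports "HOL-Analysis.Analysis"
begin

definition Q :: "real ^ 'n \<Rightarrow> real" where
  "Q x = (norm x)\<^sup>2 / 2"

text \<open>
  Integrability is part of the definition: a convex function on the open unit ball need not be
  square integrable there, and the Bochner integral of a non-integrable function is 0.
\<close>

definition mean_sq_dist_le :: "(real ^ 'n \<Rightarrow> real) \<Rightarrow> (real ^ 'n \<Rightarrow> real) \<Rightarrow> real \<Rightarrow> bool" where
  "mean_sq_dist_le u v b \<longleftrightarrow>
     set_integrable lebesgue (ball 0 1) (\<lambda>x. \<bar>u x - v x\<bar>\<^sup>2) \<and>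
     1 / measure lebesgue (ball (0 :: real ^ 'n) 1) *
       (LINT x:ball 0 1|lebesgue. \<bar>u x - v x\<bar>\<^sup>2) \<le> b"

end

theory Submission
  imports Defs
begin

text \<open>
  Put \<open>w = u - Q\<close>. Convexity of \<open>u\<close> makes \<open>w\<close> midpoint convex up to the error \<open>(norm (a - b))\<^sup>2 / 8\<close>.
  Let \<open>h = \<bar>w x\<bar>\<close> and let \<open>z\<close> be within \<open>sqrt h\<close> of \<open>x\<close>. If \<open>w x = h\<close>, midpoint convexity on the
  segment from \<open>z\<close> to its reflection \<open>2 x - z\<close> forces \<open>\<bar>w\<bar> \<ge> h / 4\<close> at one of its ends; if
  \<open>w x = - h\<close>, midpoint convexity on the segment from \<open>x\<close> to \<open>z\<close> forces \<open>\<bar>w\<bar> \<ge> h / 4\<close> at \<open>z\<close> or at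
  the midpoint. So the ball of radius \<open>r = min (sqrt h) (1/2)\<close> about \<open>x\<close> is covered by
  \<open>S = {\<bar>w\<bar> \<ge> h / 4}\<close> and one affine image of \<open>S\<close> of ratio at most 2, whence \<open>r ^ n \<lesssim> \<bar>S\<bar>\<close>, while
  \<open>\<bar>S\<bar> \<lesssim> \<delta>\<^sup>2 / h\<^sup>2\<close> by Markov's inequality. For small \<open>h\<close> this reads \<open>h powr (2 + n / 2) \<lesssim> \<delta>\<^sup>2\<close>.
\<close>

text \<open>An affine map of ratio \<open>m\<close> scales measure by
  \<open>\<bar>m\<bar> ^ CARD('n)\<close>, at most \<open>2 ^ CARD('n)\<close> here; subadditivity
  does the rest.\<close>

lemma measure_le_affine_cover:
  fixes S :: "(real ^ 'n) set"
  assumes S: "S \<in> lmeasurable" and B: "B \<in> lmeasurable"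
    and sub: "B \<subseteq> S \<union> (\<lambda>y. c + m *\<^sub>R y) ` S" and m: "m \<noteq> 0" "\<bar>m\<bar> \<le> 2"
  shows "measure lebesgue B \<le> (1 + 2 ^ CARD('n)) * measure lebesgue S"
proof -
  let ?T = "(\<lambda>y. c + m *\<^sub>R y) ` S"
  \<comment> \<open>As a preimage under the inverse scaling, the scaled set inherits measurability
    from that map.\<close>
  have "(\<lambda>y. m *\<^sub>R y) ` S = (\<lambda>y. (1/m) *\<^sub>R y) -` S \<inter> space lebesgue"
    using m(1) by (force simp: image_iff)
  also have "\<dots> \<in> sets lebesgue"
    by (rule measurable_sets[OF lebesgue_measurable_scaling]) (use S in auto)
  finally have "(\<lambda>y. m *\<^sub>R y) ` S \<in> lmeasurable"
    using emeasure_lebesgue_affine[of m 0 S] S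
    by (auto simp: fmeasurable_def ennreal_mult_less_top power_less_top_ennreal)
  then have "(+) c ` ((\<lambda>y. m *\<^sub>R y) ` S) \<in> lmeasurable"
    by (rule measurable_translation)
  then have T: "?T \<in> lmeasurable"
    by (simp add: image_image)
  have "measure lebesgue ?T = \<bar>m\<bar> ^ CARD('n) * measure lebesgue S"
    using measure_lebesgue_affine[of m c S] by (simp add: add.commute)
  also have "\<dots> \<le> 2 ^ CARD('n) * measure lebesgue S"
    by (intro mult_right_mono power_mono) (use m in auto)
  finally have mT: "measure lebesgue ?T \<le> 2 ^ CARD('n) * measure lebesgue S" .
  have "measure lebesgue B \<le> measure lebesgue (S \<union> ?T)"
    by (rule measure_mono_fmeasurable) (use sub B S T in \<open>auto intro: fmeasurable.Un\<close>)
  also have "\<dots> \<le> measure lebesgue S + measure lebesgue ?T"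
    by (rule measure_Un_le) (use S T in auto)
  finally show ?thesis
    using mT by (simp add: algebra_simps)
qed

lemma parallelogram_midpoint:
  fixes a b :: "'a::real_inner"
  shows "(norm ((1/2) *\<^sub>R (a + b)))\<^sup>2 = ((norm a)\<^sup>2 + (norm b)\<^sup>2) / 2 - (norm (a - b))\<^sup>2 / 4"
  unfolding power2_norm_eq_inner by (simp add: inner_simps inner_commute field_simps)

text \<open>By the parallelogram identity, \<open>Q\<close> at a midpoint falls short of the average
  of its end values by exactly \<open>(norm (a - b))\<^sup>2 / 8\<close>; subtracting
  \<open>Q\<close> costs this much.\<close>

lemma convex_minus_Q_midpoint:
  fixes u :: "real ^ 'n \<Rightarrow> real"
  assumes cv: "convex_on A u" and ab: "a \<in> A" "b \<in> A"
  defines "w \<equiv> \<lambda>y. u y - Q y"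
  shows "w ((1/2) *\<^sub>R (a + b)) \<le> (w a + w b) / 2 + (norm (a - b))\<^sup>2 / 8"
proof -
  have "u ((1 - 1/2) *\<^sub>R a + (1/2) *\<^sub>R b) \<le> (1 - 1/2) * u a + (1/2) * u b"
    using convex_onD[OF cv, of "1/2"] ab by auto
  then have "u ((1/2) *\<^sub>R (a + b)) \<le> (u a + u b) / 2"
    by (simp add: scaleR_add_right)
  then show ?thesis
    unfolding w_def Q_def parallelogram_midpoint by (simp add: field_simps)
qed

lemma ball_subset_affine_cover:
  fixes u :: "real ^ 'n \<Rightarrow> real"
  assumes cv: "convex_on (ball 0 1) u" and x: "x \<in> ball 0 (1/2)"
  defines "w \<equiv> \<lambda>y. u y - Q y"
  assumes r: "r \<le> 1/2" "r\<^sup>2 \<le> \<bar>w x\<bar>"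
  defines "S \<equiv> {y \<in> ball 0 1. \<bar>w y\<bar> \<ge> \<bar>w x\<bar> / 4}"
  shows "\<exists>c m. m \<noteq> 0 \<and> \<bar>m\<bar> \<le> 2 \<and> ball x r \<subseteq> S \<union> (\<lambda>y. c + m *\<^sub>R y) ` S"
proof -
  have in_ball: "y \<in> ball 0 1" if "norm (y - x) < r" for y
    using that x r(1) norm_triangle_sub[of y x] by simp
  have sq: "(norm (z - x))\<^sup>2 \<le> \<bar>w x\<bar>" if "norm (z - x) < r" for z
    using power_mono[of "norm (z - x)" r 2] that r(2) by simp
  have mid: "w ((1/2) *\<^sub>R (a + b)) \<le> (w a + w b) / 2 + (norm (a - b))\<^sup>2 / 8"
    if "a \<in> ball 0 1" "b \<in> ball 0 1" for a b
    unfolding w_def by (rule convex_minus_Q_midpoint[OF cv that])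
  show ?thesis
  proof (cases "w x \<ge> 0")
    case True
    have "z \<in> S \<union> (\<lambda>y. 2 *\<^sub>R x + (-1) *\<^sub>R y) ` S" if z: "z \<in> ball x r" for z
    proof -
      define b where "b = 2 *\<^sub>R x - z"
      have nz: "norm (z - x) < r"
        using z by (simp add: dist_norm norm_minus_commute)
      have nb: "norm (b - x) < r"
        using nz by (simp add: b_def scaleR_2 norm_minus_commute)
      have "z - b = 2 *\<^sub>R (z - x)" "(1/2) *\<^sub>R (z + b) = x"
        by (simp_all add: b_def scaleR_2)
      then have "w x \<le> (w z + w b) / 2 + (norm (z - x))\<^sup>2 / 2"
        using mid[OF in_ball[OF nz] in_ball[OF nb]] by (simp add: power_mult_distrib)
      \<comment> \<open>If both failed, the right side would be below
        \<open>\<bar>w x\<bar> / 4 + \<bar>w x\<bar> / 2\<close>, which is at most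
        \<open>w x\<close>.\<close>
      then have "\<bar>w z\<bar> \<ge> \<bar>w x\<bar> / 4 \<or> \<bar>w b\<bar> \<ge> \<bar>w x\<bar> / 4"
        using sq[OF nz] True by argo
      then have "z \<in> S \<or> b \<in> S"
        using in_ball[OF nz] in_ball[OF nb] by (auto simp: S_def)
      moreover have "z = 2 *\<^sub>R x + (-1) *\<^sub>R b"
        by (simp add: b_def)
      ultimately show ?thesis by blast
    qed
    then have "ball x r \<subseteq> S \<union> (\<lambda>y. 2 *\<^sub>R x + (-1) *\<^sub>R y) ` S"
      by (rule subsetI)
    moreover have "(-1::real) \<noteq> 0 \<and> \<bar>-1::real\<bar> \<le> 2" by simp
    ultimately show ?thesis by blast
  next
    case False
    \<comment> \<open>The map with ratio 2 inverts the contraction sending \<open>z\<close> to its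
      midpoint with \<open>x\<close>.\<close>
    have "z \<in> S \<union> (\<lambda>y. (- x) + 2 *\<^sub>R y) ` S" if z: "z \<in> ball x r" for z
    proof -
      define b where "b = (1/2) *\<^sub>R (x + z)"
      have nz: "norm (z - x) < r"
        using z by (simp add: dist_norm norm_minus_commute)
      have "b - x = (1/2) *\<^sub>R (z - x)"
        by (simp add: b_def vec_eq_iff field_simps)
      then have "norm (b - x) = norm (z - x) / 2"
        by simp
      then have nb: "norm (b - x) < r"
        using nz norm_ge_zero[of "z - x"] by linarith
      have "w b \<le> (w x + w z) / 2 + (norm (z - x))\<^sup>2 / 8"
        using mid[of x z] in_ball[OF nz] x by (simp add: b_def norm_minus_commute)
      \<comment> \<open>If the first alternative fails, \<open>w b\<close> is below \<open>- \<bar>w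
        x\<bar> / 2 + \<bar>w x\<bar> / 8 + \<bar>w x\<bar> / 8\<close>, that is, below
        \<open>- \<bar>w x\<bar> / 4\<close>.\<close>
      then have "\<bar>w z\<bar> \<ge> \<bar>w x\<bar> / 4 \<or> \<bar>w b\<bar> \<ge> \<bar>w x\<bar> / 4"
        using sq[OF nz] False by argo
      then have "z \<in> S \<or> b \<in> S"
        using in_ball[OF nz] in_ball[OF nb] by (auto simp: S_def)
      moreover have "z = (- x) + 2 *\<^sub>R b"
        by (simp add: b_def)
      ultimately show ?thesis by blast
    qed
    then have "ball x r \<subseteq> S \<union> (\<lambda>y. (- x) + 2 *\<^sub>R y) ` S"
      by (rule subsetI)
    moreover have "(2::real) \<noteq> 0 \<and> \<bar>2::real\<bar> \<le> 2" by simp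
    ultimately show ?thesis by blast
  qed
qed

lemma set_Markov_square:
  fixes w :: "'a \<Rightarrow> real"
  assumes int: "set_integrable M A (\<lambda>x. \<bar>w x\<bar>\<^sup>2)" and A: "A \<in> sets M" and t: "t > 0"
  defines "S \<equiv> {x \<in> A. \<bar>w x\<bar> \<ge> t}"
  shows "S \<in> fmeasurable M" "measure M S \<le> (LINT x:A|M. \<bar>w x\<bar>\<^sup>2) / t\<^sup>2"
proof -
  define g where "g = (\<lambda>x. indicat_real A x *\<^sub>R \<bar>w x\<bar>\<^sup>2)"
  have g: "integrable M g"
    using int unfolding set_integrable_def g_def .
  \<comment> \<open>Since \<open>t > 0\<close>, extending the square by zero outside
    \<open>A\<close> adds no point to the superlevel set.\<close>
  have S: "S = {x \<in> space M. g x \<ge> t\<^sup>2}"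
    using sets.sets_into_space[OF A] t
    by (auto simp: S_def g_def indicator_def abs_le_square_iff[symmetric] split: if_splits)
  have nonneg: "AE x in M. 0 \<le> g x"
    by (simp add: g_def)
  have "emeasure M S \<le> ennreal ((1 / t\<^sup>2) * (\<integral>x. g x \<partial>M))"
    unfolding S by (rule integral_Markov_inequality) (use g nonneg t in auto)
  also have "\<dots> < \<infinity>" by simp
  finally have fin: "emeasure M S < \<infinity>" .
  have "S \<in> sets M"
    using g unfolding S by measurable
  with fin show "S \<in> fmeasurable M" by (simp add: fmeasurable_def)
  have "measure M S \<le> (\<integral>x. g x \<partial>M) / t\<^sup>2"
    unfolding S by (rule integral_Markov_inequality_measure[OF g sets.empty_sets nonneg]) (use t in simp)
  then show "measure M S \<le> (LINT x:A|M. \<bar>w x\<bar>\<^sup>2) / t\<^sup>2"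
    by (simp add: set_lebesgue_integral_def g_def)
qed

text \<open>The cover bounds the small ball by \<open>S\<close>, and Markov at level
  \<open>h / 4\<close> bounds \<open>S\<close>, giving the 16. The volume of the unit ball cancels,
  since the mean is normalized by it.\<close>

lemma convex_deviation_power_bound:
  fixes u :: "real ^ 'n \<Rightarrow> real"
  assumes cv: "convex_on (ball 0 1) u" and ms: "mean_sq_dist_le u Q b"
    and x: "x \<in> ball 0 (1/2)"
    and h: "\<bar>u x - Q x\<bar> = h" "h > 0"
  shows "h\<^sup>2 * (min (sqrt h) (1/2)) ^ CARD('n) \<le> 16 * (1 + 2 ^ CARD('n)) * b"
proof -
  define r where "r = min (sqrt h) (1/2)"
  define S where "S = {y \<in> ball 0 1. \<bar>u y - Q y\<bar> \<ge> h / 4}"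
  define V where "V = measure lebesgue (ball (0 :: real ^ 'n) 1)"
  have r: "0 < r" "r \<le> 1/2"
    using h by (auto simp: r_def)
  have "r\<^sup>2 \<le> (sqrt h)\<^sup>2"
    by (rule power_mono) (use r in \<open>auto simp: r_def\<close>)
  then have r2: "r\<^sup>2 \<le> h" using h by simp
  have V: "V > 0" by (simp add: V_def)
  have int: "set_integrable lebesgue (ball 0 1) (\<lambda>x. \<bar>u x - Q x\<bar>\<^sup>2)"
    and le: "(LINT x:ball 0 1|lebesgue. \<bar>u x - Q x\<bar>\<^sup>2) \<le> b * V"
    using ms V by (auto simp: mean_sq_dist_le_def V_def[symmetric] field_simps)
  have S: "S \<in> lmeasurable"
    and mS: "measure lebesgue S \<le> (LINT x:ball 0 1|lebesgue. \<bar>u x - Q x\<bar>\<^sup>2) / (h/4)\<^sup>2"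
    unfolding S_def using set_Markov_square[OF int, of "h/4"] h by auto
  obtain c m where "m \<noteq> 0" "\<bar>m\<bar> \<le> 2" "ball x r \<subseteq> S \<union> (\<lambda>y. c + m *\<^sub>R y) ` S"
    using ball_subset_affine_cover[OF cv x r(2)] r2 unfolding h(1) S_def by blast
  then have "measure lebesgue (ball x r) \<le> (1 + 2 ^ CARD('n)) * measure lebesgue S"
    by (intro measure_le_affine_cover[OF S]) auto
  also have "\<dots> \<le> (1 + 2 ^ CARD('n)) * (b * V / (h/4)\<^sup>2)"
    by (intro mult_left_mono order_trans[OF mS] divide_right_mono le) auto
  also have "measure lebesgue (ball x r) = r ^ CARD('n) * V"
    using content_ball_conv_unit_ball[of r x] r by (simp add: V_def)
  finally have "r ^ CARD('n) * V \<le> ((1 + 2 ^ CARD('n)) * (16 * b / h\<^sup>2)) * V"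
    by (simp add: power_divide algebra_simps)
  then have "r ^ CARD('n) \<le> (1 + 2 ^ CARD('n)) * (16 * b / h\<^sup>2)"
    using V by (rule mult_right_le_imp_le)
  then have "h\<^sup>2 * r ^ CARD('n) \<le> h\<^sup>2 * ((1 + 2 ^ CARD('n)) * (16 * b / h\<^sup>2))"
    by (intro mult_left_mono) auto
  also have "\<dots> = 16 * (1 + 2 ^ CARD('n)) * b"
    using h(2) by simp
  finally show ?thesis
    unfolding r_def .
qed

text \<open>Solves for \<open>h\<close>. The exponent \<open>\<mu> / 2\<close> is the reciprocal of
  \<open>2 + n / 2\<close>, the total power of \<open>h\<close> while the radius is
  \<open>sqrt h\<close>. Adding the constants of the two regimes covers both.\<close>

lemma powr_bound_from_power_bound:
  fixes A h \<delta> \<Delta> :: real and n :: nat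
  assumes h: "h > 0" and A: "A > 0" and d: "0 < \<delta>" "\<delta> \<le> \<Delta>"
    and le: "h\<^sup>2 * (min (sqrt h) (1/2)) ^ n \<le> A * \<delta>\<^sup>2"
  defines "\<mu> \<equiv> 4 / (4 + real n)"
  shows "h \<le> (A powr (\<mu>/2) + sqrt (A * 2 ^ n) * \<Delta> powr (1 - \<mu>)) * \<delta> powr \<mu>"
proof -
  have mu: "0 < \<mu>" "\<mu> \<le> 1" "(2 + real n / 2) * (\<mu> / 2) = 1"
    by (auto simp: \<mu>_def field_simps)
  have "h \<le> A powr (\<mu>/2) * \<delta> powr \<mu> \<or> h \<le> sqrt (A * 2 ^ n) * \<Delta> powr (1 - \<mu>) * \<delta> powr \<mu>"
  proof (cases "sqrt h \<le> 1/2")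
    case True
    have "h\<^sup>2 * sqrt h ^ n = h powr (2 + real n / 2)"
    proof -
    have "sqrt h ^ n = (h powr (1/2)) powr real n"
      using h by (simp add: powr_half_sqrt powr_realpow)
    then show ?thesis
      using h by (simp add: powr_powr powr_add)
  qed
    then have "h powr (2 + real n / 2) \<le> A * \<delta>\<^sup>2"
      using le True by (simp add: min_absorb1)
    then have "(h powr (2 + real n / 2)) powr (\<mu>/2) \<le> (A * \<delta>\<^sup>2) powr (\<mu>/2)"
      by (intro powr_mono2) (use mu in auto)
    also have "(h powr (2 + real n / 2)) powr (\<mu>/2) = h"
      using h mu by (simp add: powr_powr)
    also have "(A * \<delta>\<^sup>2) powr (\<mu>/2) = A powr (\<mu>/2) * (\<delta>\<^sup>2) powr (\<mu>/2)"
      using A d by (simp add: powr_mult)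
    also have "(\<delta>\<^sup>2) powr (\<mu>/2) = \<delta> powr \<mu>"
      using d powr_powr[of \<delta> 2 "\<mu>/2"] by simp
    finally show ?thesis by simp
  next
    case False
    then have "h\<^sup>2 * (1/2) ^ n \<le> A * \<delta>\<^sup>2"
      using le by (simp add: min_absorb2)
    then have "h\<^sup>2 \<le> (A * 2 ^ n) * \<delta>\<^sup>2"
      by (simp add: field_simps power_divide)
    then have "sqrt (h\<^sup>2) \<le> sqrt ((A * 2 ^ n) * \<delta>\<^sup>2)"
      by (rule real_sqrt_le_mono)
    then have "h \<le> sqrt (A * 2 ^ n) * \<delta>"
      using h d by (simp add: real_sqrt_mult)
    \<comment> \<open>Once the radius is capped at 1/2 the bound is linear in \<delta>; as \<mu>
      \<le> 1, the surplus power of \<delta> is absorbed into \<Delta>.\<close>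
    also have "\<delta> = \<delta> powr (1 - \<mu>) * \<delta> powr \<mu>"
      using d powr_add[of \<delta> "1 - \<mu>" \<mu>] by simp
    also have "sqrt (A * 2 ^ n) * (\<delta> powr (1 - \<mu>) * \<delta> powr \<mu>)
        \<le> sqrt (A * 2 ^ n) * (\<Delta> powr (1 - \<mu>) * \<delta> powr \<mu>)"
      by (intro mult_left_mono mult_right_mono powr_mono2) (use d mu A in auto)
    finally show ?thesis by (simp add: mult.assoc)
  qed
  moreover have "0 \<le> A powr (\<mu>/2) * \<delta> powr \<mu>"
    "0 \<le> sqrt (A * 2 ^ n) * \<Delta> powr (1 - \<mu>) * \<delta> powr \<mu>"
    using A by auto
  ultimately show ?thesis
    unfolding distrib_right by linarith
qed

text \<open>\<open>K\<close> is the implied constant of the hypothesis, and \<open>C\<close> is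
  chosen before \<delta> and \<open>u\<close>. The cap \<Delta> matters:
  \<open>u = Q + sqrt K * \<delta>\<close> deviates linearly in \<delta>, which outgrows the claimed
  power for large \<delta>.\<close>

theorem lemma3p5:
  fixes p \<alpha> C\<^sub>0 K \<Delta> :: real
  assumes "CARD('n::finite) \<ge> 2"
    and "p > real CARD('n)"
    and "0 < \<alpha>" and "\<alpha> < 1"
    and "C\<^sub>0 > 0"
    and "K > 0" and "\<Delta> > 0"
  shows "\<exists>C>0. \<forall>(\<delta>::real) (u :: real ^ 'n \<Rightarrow> real).
           0 < \<delta> \<longrightarrow> \<delta> \<le> \<Delta> \<longrightarrow>
           mean_sq_dist_le u Q (K * \<delta>\<^sup>2) \<longrightarrow>
           convex_on (ball 0 1) u \<longrightarrow>
           (\<forall>x\<in>ball 0 (1/2). \<bar>u x - Q x\<bar> \<le> C * \<delta> powr (4 / (4 + real CARD('n))))"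
proof -
  define A where "A = 16 * (1 + 2 ^ CARD('n)) * K"
  define \<mu> where "\<mu> = 4 / (4 + real CARD('n))"
  define C where "C = A powr (\<mu>/2) + sqrt (A * 2 ^ CARD('n)) * \<Delta> powr (1 - \<mu>)"
  have A: "A > 0"
    using \<open>K > 0\<close> by (simp add: A_def add_pos_pos)
  have C: "C > 0"
    using A by (simp add: C_def add_pos_nonneg)
  have "\<bar>u x - Q x\<bar> \<le> C * \<delta> powr \<mu>"
    if d: "0 < \<delta>" "\<delta> \<le> \<Delta>" and ms: "mean_sq_dist_le u Q (K * \<delta>\<^sup>2)"
      and cv: "convex_on (ball 0 1) u" and x: "x \<in> ball 0 (1/2)"
    for \<delta> and u :: "real ^ 'n \<Rightarrow> real" and x
  proof (cases "\<bar>u x - Q x\<bar> > 0")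
    case True
    then show ?thesis
      using powr_bound_from_power_bound[OF True A d, of "CARD('n)"]
        convex_deviation_power_bound[OF cv ms x refl True]
      by (simp add: A_def C_def \<mu>_def mult.assoc)
  qed (use C in simp)
  with C show ?thesis
    unfolding \<mu>_def by blast
qed

end
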